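(* For every integer $n \ge 1$, the reciprocal $\overline{G}_n = 1/G_n$ of the unreduced Farey product $G_n$ is given by the product of binomial coefficients $$\overline{G}_n = \prod_{j=0}^{n} \binom{n}{j}.$$ Thus $1/G_n$ is always an integer.
   Context: For $n\ge 1$, the positive unreduced Farey sequence of order $n$ is the family $\mathcal{G}_n^{\ast}$ of all (reduced and unreduced) fractions $\frac{h}{k}$ with integers $1 \le h \le k \le n$, where each pair $(h,k)$ is counted separately (so equal rational values coming from different pairs are listed with multiplicity). The unreduced Farey product is $G_n := \prod_{1 \le h \le k \le n} \frac{h}{k}$, the product of all these fractions. *)

theory Defs
  imports Complex_Main
begin

text \<open>
  The positive unreduced Farey sequence is represented by its index set of pairs
  \<open>(h, k)\<close> rather than by the set of values \<open>h / k\<close>, so that equal values coming from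
  different pairs are kept with multiplicity.
\<close>

definition unreduced_farey :: "nat \<Rightarrow> (nat \<times> nat) set" where
  "unreduced_farey n = {(h, k). 1 \<le> h \<and> h \<le> k \<and> k \<le> n}"

definition unreduced_farey_product :: "nat \<Rightarrow> rat" where
  "unreduced_farey_product n = (\<Prod>(h, k)\<in>unreduced_farey n. of_nat h / of_nat k)"

definition recip_unreduced_farey_product :: "nat \<Rightarrow> rat" where
  "recip_unreduced_farey_product n = 1 / unreduced_farey_product n"

text \<open>
  The index set is finite and the product is nonzero, so neither the value of \<open>prod\<close> on
  infinite sets nor division by zero plays a role.
\<close>

lemma finite_unreduced_farey: "finite (unreduced_farey n)"
  by (rule finite_subset[of _ "{..n} \<times> {..n}"]) (auto simp: unreduced_farey_def)

lemma unreduced_farey_product_pos: "unreduced_farey_product n > 0"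
  unfolding unreduced_farey_product_def by (rule prod_pos) (auto simp: unreduced_farey_def)

end

theory Submission
  imports Defs
begin

text \<open>
  Both sides satisfy the same first-order recurrence in \<open>n\<close>, and both equal \<open>1\<close> at \<open>n = 0\<close>.
  Passing from order \<open>n - 1\<close> to order \<open>n\<close> adds exactly the fractions \<open>h / n\<close> with
  \<open>1 \<le> h \<le> n\<close>, whose product is \<open>n! / n ^ n\<close>; so the reciprocal product is multiplied by
  \<open>n ^ n / n!\<close>.  The product of a row of Pascal's triangle is multiplied by the same factor,
  because each entry of row \<open>n\<close> except the last, which is \<open>1\<close>, arises from the entry above it by
  \<open>(n choose j) = n / (n - j) * (n - 1 choose j)\<close>, and the denominators \<open>n - j\<close> with \<open>j < n\<close>
  multiply to \<open>n!\<close>.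
\<close>

lemma unreduced_farey_0: "unreduced_farey 0 = {}"
  by (auto simp: unreduced_farey_def)

lemma unreduced_farey_Suc:
  "unreduced_farey (Suc n) = unreduced_farey n \<union> (\<lambda>h. (h, Suc n)) ` {1..Suc n}"
  by (auto simp: unreduced_farey_def le_Suc_eq)

lemma unreduced_farey_product_Suc:
  "unreduced_farey_product (Suc n) =
     unreduced_farey_product n * (fact (Suc n) / of_nat (Suc n) ^ Suc n)"
proof -
  let ?f = "\<lambda>(h, k). of_nat h / of_nat k :: rat"
  let ?R = "(\<lambda>h. (h, Suc n)) ` {1..Suc n}"
  have disjoint: "unreduced_farey n \<inter> ?R = {}"
    by (auto simp: unreduced_farey_def)
  have "prod ?f ?R = (\<Prod>h=1..Suc n. of_nat h / of_nat (Suc n))"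
    by (subst prod.reindex) (auto simp: inj_on_def)
  also have "\<dots> = fact (Suc n) / of_nat (Suc n) ^ Suc n"
    by (simp only: prod_dividef fact_prod prod_constant card_atLeastAtMost diff_Suc_1 of_nat_prod)
  finally show ?thesis
    unfolding unreduced_farey_product_def unreduced_farey_Suc
    using prod.union_disjoint[OF finite_unreduced_farey _ disjoint, of ?f] by simp
qed

text \<open>
  This is the recurrence between consecutive row products of Pascal's triangle, with the
  denominators of the absorption identity cleared so that it can be stated in \<open>nat\<close>.
\<close>

lemma prod_binomial_Suc:
  "fact (Suc n) * (\<Prod>j=0..Suc n. Suc n choose j) = Suc n ^ Suc n * (\<Prod>j=0..n. n choose j)"
proof -
  have "fact (Suc n) = (\<Prod>j=0..n. Suc n - j)"
    using fact_prod_rev[of "Suc n", where ?'a = nat]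
    by (simp add: atLeastLessThanSuc_atLeastAtMost del: fact_Suc)
  then have "fact (Suc n) * (\<Prod>j=0..Suc n. Suc n choose j)
      = (\<Prod>j=0..n. (Suc n - j) * (Suc n choose j))"
    by (simp add: prod.distrib del: fact_Suc binomial_Suc_Suc)
  also have "\<dots> = (\<Prod>j=0..n. Suc n * (n choose j))"
    by (simp only: binomial_absorb_comp diff_Suc_1)
  also have "\<dots> = Suc n ^ Suc n * (\<Prod>j=0..n. n choose j)"
    by (simp only: prod.distrib prod_constant card_atLeastAtMost diff_zero)
  finally show ?thesis .
qed

lemma recip_unreduced_farey_product_eq:
  "recip_unreduced_farey_product n = of_nat (\<Prod>j=0..n. n choose j)"
proof (induction n)
  case 0
  show ?case
    by (simp add: recip_unreduced_farey_product_def unreduced_farey_product_def unreduced_farey_0)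
next
  case (Suc n)
  have "fact (Suc n) * recip_unreduced_farey_product (Suc n)
      = of_nat (Suc n) ^ Suc n * recip_unreduced_farey_product n"
    unfolding recip_unreduced_farey_product_def unreduced_farey_product_Suc
    by (simp add: field_simps del: fact_Suc power_Suc of_nat_Suc)
  also have "\<dots> = of_nat (Suc n ^ Suc n * (\<Prod>j=0..n. n choose j))"
    by (simp only: Suc.IH of_nat_mult of_nat_power)
  also have "\<dots> = fact (Suc n) * of_nat (\<Prod>j=0..Suc n. Suc n choose j)"
    by (simp only: prod_binomial_Suc[symmetric] of_nat_mult of_nat_fact)
  finally show ?case
    by (simp only: mult_cancel_left fact_nonzero simp_thms)
qed

theorem theorem2p1:
  fixes n :: nat
  assumes "n \<ge> 1"
  shows "recip_unreduced_farey_product n = (\<Prod>j=0..n. of_nat (n choose j))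
    \<and> recip_unreduced_farey_product n \<in> \<int>"
proof
  show "recip_unreduced_farey_product n = (\<Prod>j=0..n. of_nat (n choose j))"
    by (simp add: recip_unreduced_farey_product_eq)
  show "recip_unreduced_farey_product n \<in> \<int>"
    unfolding recip_unreduced_farey_product_eq by (rule Ints_of_nat)
qed

end
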